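(* Let $d\ge1$ be an integer and let $(X_n)_{n\ge1}$ be a sequence of random finite $d$-dimensional simplicial complexes that converges locally weakly in probability to a random $(d-1)$-rooted simplicial complex $(X,o)\sim\mu$. Let $C_n$ denote the number of $d$-dimensional connected components in $X_n$. Then $$\frac{C_n}{s_{d-1}(X_n)}\overset{\mathbb P}{\longrightarrow}\mathbb E_\mu\left[\frac1{s_{d-1}(\mathcal C(o))}\right],$$ where $\mathcal C(o)$ denotes the $d$-dimensional connected component in $X$ containing $o$, and by convention $1/s_{d-1}(\mathcal C(o))=0$ when $s_{d-1}(\mathcal C(o))=\infty$.
   Context: A simplicial complex $X$ is a collection of finite nonempty sets (simplices) closed under taking nonempty subsets; $\sigma\in X$ has dimension $|\sigma|-1$. $S_k(X)$ is the set of $k$-simplices, $s_k(X)=|S_k(X)|$. "$d$-dimensional complex" allows dimension at most $d$. Components: two elements of $S_{d-1}(X)$ are adjacent if both lie in a common $d$-simplex of $X$; the classes of the transitive-reflexive closure of this relation on $S_{d-1}(X)$ are the $d$-dimensional connected components. $\mathcal C(\sigma)$ is the component containing $\sigma$, and $s_{d-1}(\mathcal C)$ is the number of $(d-1)$-simplices in $\mathcal C$. Rooted complexes: a $(d-1)$-rooted simplicial complex is a pair $(X,\sigma)$ with $\sigma\in S_{d-1}(X)$. Two such pairs are isomorphic ($\cong$) if there is a bijection of vertex sets preserving simplices in both directions and mapping root onto root. $X$ is locally finite above dimension $d-1$ if every $(d-1)$-simplex lies in finitely many $d$-simplices. $\mathcal S_{d-1}$ is the set of isomorphism classes of $(d-1)$-rooted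 simplicial complexes locally finite above dimension $d-1$; $(X,o)$ is a random element of $\mathcal S_{d-1}$. Neighborhoods: $Q(\sigma)$ is the set of all nonempty subsets of $\sigma$. Put $B_X(\sigma;0)=Q(\sigma)$; given $B_X(\sigma;\ell)$, let $\mathcal J_\ell$ be the set of $d$-simplices of $X$ not in $B_X(\sigma;\ell)$ that contain at least one $(d-1)$-simplex belonging to $B_X(\sigma;\ell)$, and set $B_X(\sigma;\ell+1)=B_X(\sigma;\ell)\cup\bigcup_{\rho\in\mathcal J_\ell}Q(\rho)$. $B_X(\sigma;r)$ is regarded as rooted at $\sigma$. Local-weak convergence in probability of $(X_n)$ to $(X,o)$ with (possibly random) law $\mu$ means: for every integer $r\ge0$ and every $H_*\in\mathcal S_{d-1}$, $$\frac1{s_{d-1}(X_n)}\sum_{\sigma\in S_{d-1}(X_n)}\mathbf 1\{B_{X_n}(\sigma;r)\cong H_*\}\overset{\mathbb P}{\longrightarrow}\mu\big(B_X(o;r)\cong H_*\big).$$ $\mathbb E_\mu$ is expectation under $\mu$. *)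

theory Defs
  imports "HOL-Probability.Probability"
begin

section \<open>Simplicial complexes and their components\<close>

type_synonym 'v scomplex = "'v set set"

definition simplicial_complex :: "'v scomplex \<Rightarrow> bool" where
  "simplicial_complex X \<longleftrightarrow>
     (\<forall>\<sigma>\<in>X. finite \<sigma> \<and> \<sigma> \<noteq> {} \<and> (\<forall>\<tau>. \<tau> \<subseteq> \<sigma> \<and> \<tau> \<noteq> {} \<longrightarrow> \<tau> \<in> X))"

definition simplices :: "nat \<Rightarrow> 'v scomplex \<Rightarrow> 'v set set" where
  "simplices k X = {\<sigma> \<in> X. card \<sigma> = k + 1}"

text \<open>Dimension at most \<open>d\<close>; the dimension need not be attained.\<close>

definition dim_complex :: "nat \<Rightarrow> 'v scomplex \<Rightarrow> bool" where
  "dim_complex d X \<longleftrightarrow> simplicial_complex X \<and> (\<forall>\<sigma>\<in>X. card \<sigma> \<le> d + 1)"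

text \<open>Below, \<open>d - 1\<close> is truncated subtraction; the notions are meant for \<open>d \<ge> 1\<close>.\<close>

definition adjacent :: "nat \<Rightarrow> 'v scomplex \<Rightarrow> ('v set \<times> 'v set) set" where
  "adjacent d X = {(\<sigma>, \<tau>). \<sigma> \<in> simplices (d - 1) X \<and> \<tau> \<in> simplices (d - 1) X \<and>
     (\<exists>\<rho>\<in>simplices d X. \<sigma> \<subseteq> \<rho> \<and> \<tau> \<subseteq> \<rho>)}"

definition connected_rel :: "nat \<Rightarrow> 'v scomplex \<Rightarrow> ('v set \<times> 'v set) set" where
  "connected_rel d X = (adjacent d X)\<^sup>* \<inter> simplices (d - 1) X \<times> simplices (d - 1) X"

definition d_components :: "nat \<Rightarrow> 'v scomplex \<Rightarrow> 'v set set set" where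
  "d_components d X = simplices (d - 1) X // connected_rel d X"

definition component_of :: "nat \<Rightarrow> 'v scomplex \<Rightarrow> 'v set \<Rightarrow> 'v set set" where
  "component_of d X \<sigma> = connected_rel d X `` {\<sigma>}"


section \<open>Rooted complexes and neighborhoods\<close>

type_synonym 'v rooted = "'v scomplex \<times> 'v set"

definition complex_iso_map :: "('a \<Rightarrow> 'b) \<Rightarrow> 'a scomplex \<Rightarrow> 'b scomplex \<Rightarrow> bool" where
  "complex_iso_map f X Y \<longleftrightarrow>
     bij_betw f (\<Union>X) (\<Union>Y) \<and> (\<forall>\<sigma>. \<sigma> \<subseteq> \<Union>X \<longrightarrow> (\<sigma> \<in> X \<longleftrightarrow> f ` \<sigma> \<in> Y))"

definition complex_iso :: "'a scomplex \<Rightarrow> 'b scomplex \<Rightarrow> bool" where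
  "complex_iso X Y \<longleftrightarrow> (\<exists>f. complex_iso_map f X Y)"

definition rooted_iso :: "'a rooted \<Rightarrow> 'b rooted \<Rightarrow> bool" where
  "rooted_iso p q \<longleftrightarrow> (\<exists>f. complex_iso_map f (fst p) (fst q) \<and> f ` snd p = snd q)"

definition locally_finite_above :: "nat \<Rightarrow> 'v scomplex \<Rightarrow> bool" where
  "locally_finite_above d X \<longleftrightarrow>
     (\<forall>\<sigma>\<in>simplices (d - 1) X. finite {\<rho> \<in> simplices d X. \<sigma> \<subseteq> \<rho>})"

text \<open>The dimension of a rooted complex is unrestricted: simplices of dimension above \<open>d\<close> are
  permitted, and local finiteness only concerns \<open>d\<close>-simplices around \<open>(d - 1)\<close>-simplices.\<close>

definition rooted_complexes :: "nat \<Rightarrow> 'v rooted set" where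
  "rooted_complexes d = {(X, \<sigma>). simplicial_complex X \<and> \<sigma> \<in> simplices (d - 1) X \<and>
     locally_finite_above d X}"

definition rooted_classes :: "nat \<Rightarrow> 'v rooted set set" where
  "rooted_classes d = rooted_complexes d //
     {(p, q). p \<in> rooted_complexes d \<and> q \<in> rooted_complexes d \<and> rooted_iso p q}"

text \<open>A rooted complex may have its vertices in another type than the members of the class.\<close>

definition in_iso_class :: "'a rooted \<Rightarrow> 'b rooted set \<Rightarrow> bool" where
  "in_iso_class p H \<longleftrightarrow> (\<exists>q\<in>H. rooted_iso p q)"

text \<open>An arbitrary member of a class. It is only used inside isomorphism-invariant expressions.\<close>

definition rep :: "'v rooted set \<Rightarrow> 'v rooted" where
  "rep c = (SOME p. p \<in> c)"

definition faces :: "'v set \<Rightarrow> 'v scomplex" where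
  "faces \<sigma> = {\<tau>. \<tau> \<subseteq> \<sigma> \<and> \<tau> \<noteq> {}}"

fun nbhd_complex :: "nat \<Rightarrow> 'v scomplex \<Rightarrow> 'v set \<Rightarrow> nat \<Rightarrow> 'v scomplex" where
  "nbhd_complex d X \<sigma> 0 = faces \<sigma>"
| "nbhd_complex d X \<sigma> (Suc l) = nbhd_complex d X \<sigma> l \<union>
     (\<Union>\<rho> \<in> {\<rho> \<in> simplices d X. \<rho> \<notin> nbhd_complex d X \<sigma> l \<and>
              (\<exists>\<tau>\<in>simplices (d - 1) X. \<tau> \<subseteq> \<rho> \<and> \<tau> \<in> nbhd_complex d X \<sigma> l)}. faces \<rho>)"

definition nbhd :: "nat \<Rightarrow> 'v rooted \<Rightarrow> nat \<Rightarrow> 'v rooted" where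
  "nbhd d p r = (nbhd_complex d (fst p) (snd p) r, snd p)"


section \<open>Laws of random rooted complexes\<close>

text \<open>Isomorphism classes carry the \<open>\<sigma>\<close>-algebra generated by the events
  \<open>B\<^sub>X(o;r) \<cong> H\<close>, the coarsest one for which the probabilities of these events are defined.\<close>

definition rooted_class_space :: "nat \<Rightarrow> 'v rooted set measure" where
  "rooted_class_space d = sigma (rooted_classes d)
     {{c \<in> rooted_classes d. in_iso_class (nbhd d (rep c) r) H} |r H :: 'v rooted set. H \<in> rooted_classes d}"

definition nbhd_prob :: "nat \<Rightarrow> 'v rooted set measure \<Rightarrow> nat \<Rightarrow> 'v rooted set \<Rightarrow> real" where
  "nbhd_prob d \<mu> r H = measure \<mu> {c \<in> space \<mu>. in_iso_class (nbhd d (rep c) r) H}"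

definition inv_component_size :: "nat \<Rightarrow> 'v rooted set \<Rightarrow> real" where
  "inv_component_size d c =
     (let C = component_of d (fst (rep c)) (snd (rep c))
      in if finite C then 1 / real (card C) else 0)"


section \<open>Random finite complexes and local-weak convergence in probability\<close>

text \<open>The vertex type is arbitrary, so no \<open>\<sigma>\<close>-algebra on labelled complexes is singled out:
  a random finite complex is only required to have a measurable isomorphism type. Every
  measurable map into the discrete space of finite complexes has this property.\<close>

definition random_finite_complex :: "'w measure \<Rightarrow> nat \<Rightarrow> ('w \<Rightarrow> 'a scomplex) \<Rightarrow> bool" where
  "random_finite_complex M d X \<longleftrightarrow>
     (\<forall>\<omega>\<in>space M. finite (X \<omega>) \<and> dim_complex d (X \<omega>)) \<and>
     (\<forall>K :: 'a scomplex. finite K \<and> dim_complex d K \<longrightarrow>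
        {\<omega> \<in> space M. complex_iso (X \<omega>) K} \<in> sets M)"

definition converges_in_prob ::
    "'w measure \<Rightarrow> (nat \<Rightarrow> 'w \<Rightarrow> real) \<Rightarrow> ('w \<Rightarrow> real) \<Rightarrow> bool" where
  "converges_in_prob M Y Z \<longleftrightarrow>
     (\<forall>n. Y n \<in> borel_measurable M) \<and> Z \<in> borel_measurable M \<and>
     (\<forall>\<epsilon>>0. (\<lambda>n. measure M {\<omega> \<in> space M. \<bar>Y n \<omega> - Z \<omega>\<bar> > \<epsilon>}) \<longlonglongrightarrow> 0)"

text \<open>The fraction is \<open>0\<close> if \<open>X\<close> has no \<open>(d - 1)\<close>-simplex. Under local-weak
  convergence in probability this event has vanishing probability.\<close>

definition nbhd_fraction :: "nat \<Rightarrow> 'a scomplex \<Rightarrow> nat \<Rightarrow> 'v rooted set \<Rightarrow> real" where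
  "nbhd_fraction d X r H = 1 / real (card (simplices (d - 1) X)) *
     (\<Sum>\<sigma>\<in>simplices (d - 1) X. of_bool (in_iso_class (nbhd d (X, \<sigma>) r) H))"

definition local_weak_conv_in_prob ::
    "'w measure \<Rightarrow> nat \<Rightarrow> (nat \<Rightarrow> 'w \<Rightarrow> 'a scomplex) \<Rightarrow> ('w \<Rightarrow> 'v rooted set measure) \<Rightarrow> bool" where
  "local_weak_conv_in_prob M d X \<mu> \<longleftrightarrow>
     (\<forall>r. \<forall>H\<in>rooted_classes d.
        converges_in_prob M (\<lambda>n \<omega>. nbhd_fraction d (X n \<omega>) r H) (\<lambda>\<omega>. nbhd_prob d (\<mu> \<omega>) r H))"

end

theory Submission
  imports Defs
begin

text \<open>Letting every \<open>(d - 1)\<close>-simplex \<open>\<sigma>\<close> carry the weight \<open>1 / |C(\<sigma>)|\<close>, each component receives total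
  weight 1. Hence the number of components divided by the number of \<open>(d - 1)\<close>-simplices is the
  average of \<open>1 / |C(\<sigma>)|\<close> over \<open>\<sigma>\<close> (\<open>card_quotient_eq_sum\<close>, \<open>component_density_eq\<close>). The limit is the
  expectation of the same function of a rooted complex, so the task is to pass an average of
  this function to the limit, although no bounded neighborhood of the root determines it.

  It is uniformly close to functions that do. As long as the neighborhood of radius \<open>r\<close> has not
  exhausted the component, the next one contains a new \<open>(d - 1)\<close>-simplex. So at radius \<open>k\<close> either
  more than \<open>k\<close> of them are visible or the entire component is (\<open>card_nbhd_le_iff_component\<close>).
  Therefore the truncation, which equals \<open>1 / |C(\<sigma>)|\<close> if \<open>|C(\<sigma>)| \<le> k\<close> and \<open>0\<close> otherwise, is a
  function of the neighborhood of radius \<open>k\<close>, and it differs from the original weight by at most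
  \<open>1 / (k + 1)\<close> for every rooted complex, infinite components included.

  Truncation also makes tightness automatic. Every vertex of a neighborhood lies in one of its
  \<open>(d - 1)\<close>-simplices, so a neighborhood with at most \<open>k\<close> of these has at most \<open>d * k\<close> vertices. Only
  finitely many isomorphism classes remain, and the truncated weight is a finite linear combination
  of the events \<open>B(\<sigma>; k) \<cong> H\<close> (\<open>trunc_inv_size_eq_sum\<close>). Local-weak convergence applies to each of
  these events, finite linear combinations preserve convergence in probability, and the uniform
  error disappears as \<open>k\<close> grows (\<open>converges_in_prob_uniform_approx\<close>). Measurability of both sides
  comes from the same approximation.

  The classes consist of complexes on vertices of a type that may differ from the vertex type of the
  random complexes. Since the former is infinite, every finite neighborhood has a copy there
  (\<open>rooted_iso_copy\<close>).\<close>


section \<open>Counting components\<close>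

lemma equiv_connected_rel: "equiv (simplices (d - 1) X) (connected_rel d X)"
proof (rule equivI)
  show "connected_rel d X \<subseteq> simplices (d - 1) X \<times> simplices (d - 1) X"
    by (auto simp: connected_rel_def)
  show "refl_on (simplices (d - 1) X) (connected_rel d X)"
    by (auto simp: refl_on_def connected_rel_def)
  have "sym (adjacent d X)"
    by (auto simp: sym_def adjacent_def)
  then have "sym ((adjacent d X)\<^sup>*)"
    by (rule sym_rtrancl)
  then show "sym (connected_rel d X)"
    by (auto simp: sym_def connected_rel_def)
  show "trans (connected_rel d X)"
    by (auto simp: trans_def connected_rel_def intro: rtrancl_trans)
qed

lemma mem_component_of_iff:
  "\<tau> \<in> component_of d X \<sigma> \<longleftrightarrow>
     (\<sigma>, \<tau>) \<in> (adjacent d X)\<^sup>* \<and> \<sigma> \<in> simplices (d - 1) X \<and> \<tau> \<in> simplices (d - 1) X"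
  by (auto simp: component_of_def connected_rel_def)

lemma component_of_self: "\<sigma> \<in> simplices (d - 1) X \<Longrightarrow> \<sigma> \<in> component_of d X \<sigma>"
  by (auto simp: mem_component_of_iff)

text \<open>The terms belonging to one equivalence class add up to 1.\<close>

lemma card_quotient_eq_sum:
  assumes "finite A" "equiv A r"
  shows "real (card (A // r)) = (\<Sum>a\<in>A. 1 / real (card (r `` {a})))"
proof -
  have "(\<Sum>a\<in>A. 1 / real (card (r `` {a}))) = (\<Sum>a\<in>\<Union>(A // r). 1 / real (card (r `` {a})))"
    using assms(2) by (simp add: Union_quotient)
  also have "\<dots> = (\<Sum>C\<in>A // r. \<Sum>a\<in>C. 1 / real (card (r `` {a})))"
  proof (subst sum.Union_disjoint)
    show "\<forall>C\<in>A // r. finite C"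
      using assms by (meson equiv_type finite_equiv_class)
    show "\<forall>C\<in>A // r. \<forall>D\<in>A // r. C \<noteq> D \<longrightarrow> C \<inter> D = {}"
      using quotient_disj[OF assms(2)] by blast
  qed simp
  also have "\<dots> = (\<Sum>C\<in>A // r. 1)"
  proof (rule sum.cong)
    fix C assume C: "C \<in> A // r"
    have "finite C"
      using assms C by (meson equiv_type finite_equiv_class)
    moreover have "C \<noteq> {}"
      using in_quotient_imp_non_empty[OF assms(2) C] .
    moreover have "r `` {a} = C" if "a \<in> C" for a
      using C assms(2) that
      by (smt (verit, ccfv_SIG) Image_singleton_iff equiv_class_eq_iff quotientE)
    ultimately show "(\<Sum>a\<in>C. 1 / real (card (r `` {a}))) = 1"
      by simp
  qed simp
  finally show ?thesis
    by simp
qed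


section \<open>Neighborhoods exhaust the component of the root\<close>

lemma rooted_complexesD:
  assumes "(X, \<sigma>) \<in> rooted_complexes d"
  shows "simplicial_complex X" "\<sigma> \<in> simplices (d - 1) X" "locally_finite_above d X"
  using assms by (auto simp: rooted_complexes_def)

lemma simplicial_complex_faces: "\<sigma> \<in> X \<Longrightarrow> simplicial_complex X \<Longrightarrow> faces \<sigma> \<subseteq> X"
  unfolding simplicial_complex_def faces_def by blast

lemma simplex_finite: "\<sigma> \<in> simplices k X \<Longrightarrow> finite \<sigma>"
  by (auto simp: simplices_def intro: card_ge_0_finite)

lemma mem_faces_self: "\<sigma> \<in> simplices k X \<Longrightarrow> \<sigma> \<in> faces \<sigma>"
  by (auto simp: simplices_def faces_def)

text \<open>The recursion only adds faces of \<open>d\<close>-simplices outside the previous neighborhood. In arguments by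
  induction it is enough that a new simplex is a face of a \<open>d\<close>-simplex \<open>\<rho>\<close> that is absorbed entirely
  and touches the previous neighborhood along some \<open>\<tau>\<close>.\<close>

lemma nbhd_complex_Suc_cases:
  assumes "\<upsilon> \<in> nbhd_complex d X \<sigma> (Suc r)"
  obtains (old) "\<upsilon> \<in> nbhd_complex d X \<sigma> r"
    | (new) \<rho> \<tau> where "\<rho> \<in> simplices d X" "\<upsilon> \<in> faces \<rho>" "faces \<rho> \<subseteq> nbhd_complex d X \<sigma> (Suc r)"
        "\<tau> \<in> simplices (d - 1) X" "\<tau> \<subseteq> \<rho>" "\<tau> \<in> nbhd_complex d X \<sigma> r"
  using assms unfolding nbhd_complex.simps by blast

lemma nbhd_complex_subset:
  assumes "simplicial_complex X" "\<sigma> \<in> X"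
  shows "nbhd_complex d X \<sigma> r \<subseteq> X"
proof (induction r)
  case 0
  then show ?case using simplicial_complex_faces assms by auto
next
  case (Suc r)
  have "faces \<rho> \<subseteq> X" if "\<rho> \<in> simplices d X" for \<rho>
    using that assms(1) by (intro simplicial_complex_faces) (auto simp: simplices_def)
  then show ?case using Suc by auto
qed

lemma simplicial_complex_nbhd_complex:
  assumes "simplicial_complex X" "\<sigma> \<in> X"
  shows "simplicial_complex (nbhd_complex d X \<sigma> r)"
proof -
  have closed: "\<tau> \<in> nbhd_complex d X \<sigma> r"
    if "\<upsilon> \<in> nbhd_complex d X \<sigma> r" "\<tau> \<subseteq> \<upsilon>" "\<tau> \<noteq> {}" for \<tau> \<upsilon>
    using that(1)
  proof (induction r)
    case 0
    then show ?case using that(2,3) by (auto simp: faces_def)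
  next
    case (Suc r)
    from Suc.prems show ?case
    proof (cases rule: nbhd_complex_Suc_cases)
      case old
      then show ?thesis using Suc.IH by simp
    next
      case (new \<rho>)
      have "\<tau> \<in> faces \<rho>" using new(2) that(2,3) unfolding faces_def by blast
      then show ?thesis using new(3) by blast
    qed
  qed
  moreover have "finite \<upsilon> \<and> \<upsilon> \<noteq> {}" if "\<upsilon> \<in> nbhd_complex d X \<sigma> r" for \<upsilon>
    using nbhd_complex_subset[OF assms] that assms(1) by (auto simp: simplicial_complex_def)
  ultimately show ?thesis
    unfolding simplicial_complex_def by blast
qed

lemma nbhd_complex_mono: "r \<le> s \<Longrightarrow> nbhd_complex d X \<sigma> r \<subseteq> nbhd_complex d X \<sigma> s"
  by (rule lift_Suc_mono_le[of "nbhd_complex d X \<sigma>"]) auto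

lemma root_in_nbhd_complex:
  assumes "\<sigma> \<in> simplices (d - 1) X"
  shows "\<sigma> \<in> simplices (d - 1) (nbhd_complex d X \<sigma> r)"
  using nbhd_complex_mono[of 0 r d X \<sigma>] mem_faces_self[OF assms] assms
  by (auto simp: simplices_def)

lemma finite_nbhd_complex:
  assumes "(X, \<sigma>) \<in> rooted_complexes d"
  shows "finite (nbhd_complex d X \<sigma> r)"
proof (induction r)
  case 0
  then show ?case
    using simplex_finite[OF rooted_complexesD(2)[OF assms]] by (simp add: faces_def)
next
  case (Suc r)
  let ?B = "nbhd_complex d X \<sigma> r"
  let ?J = "{\<rho> \<in> simplices d X. \<rho> \<notin> ?B \<and> (\<exists>\<tau>\<in>simplices (d - 1) X. \<tau> \<subseteq> \<rho> \<and> \<tau> \<in> ?B)}"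
  have "?J \<subseteq> (\<Union>\<tau>\<in>simplices (d - 1) X \<inter> ?B. {\<rho> \<in> simplices d X. \<tau> \<subseteq> \<rho>})"
    by auto
  moreover have "finite \<dots>"
    using Suc rooted_complexesD(3)[OF assms] by (auto simp: locally_finite_above_def)
  ultimately have "finite ?J"
    by (rule finite_subset)
  moreover have "finite (faces \<rho>)" if "\<rho> \<in> ?J" for \<rho>
    using that by (auto simp: faces_def dest: simplex_finite)
  ultimately have "finite (\<Union>\<rho>\<in>?J. faces \<rho>)"
    by (rule finite_UN_I)
  then show ?case using Suc by simp
qed

lemma faces_subset_nbhd_complex_Suc:
  assumes "simplicial_complex X" "\<sigma> \<in> X" "\<tau> \<in> simplices (d - 1) X" "\<tau> \<in> nbhd_complex d X \<sigma> r"
    "\<rho> \<in> simplices d X" "\<tau> \<subseteq> \<rho>"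
  shows "faces \<rho> \<subseteq> nbhd_complex d X \<sigma> (Suc r)"
proof (cases "\<rho> \<in> nbhd_complex d X \<sigma> r")
  case True
  then show ?thesis
    using simplicial_complex_faces[OF _ simplicial_complex_nbhd_complex] assms(1,2) by fastforce
next
  case False
  then show ?thesis using assms by auto
qed

lemma simplices_nbhd_complex_subset_component:
  assumes "simplicial_complex X" "\<sigma> \<in> simplices (d - 1) X"
  shows "simplices (d - 1) (nbhd_complex d X \<sigma> r) \<subseteq> component_of d X \<sigma>"
proof (induction r)
  case 0
  have "\<tau> = \<sigma>" if "\<tau> \<subseteq> \<sigma>" "card \<tau> = card \<sigma>" for \<tau>
    using that simplex_finite[OF assms(2)] by (simp add: card_subset_eq)
  then have "simplices (d - 1) (nbhd_complex d X \<sigma> 0) \<subseteq> {\<sigma>}"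
    using assms(2) by (auto simp: faces_def simplices_def)
  then show ?case
    using component_of_self[OF assms(2)] by blast
next
  case (Suc r)
  let ?B = "nbhd_complex d X \<sigma>"
  have \<sigma>: "\<sigma> \<in> X"
    using assms(2) by (simp add: simplices_def)
  show ?case
  proof
    fix \<upsilon> assume \<upsilon>: "\<upsilon> \<in> simplices (d - 1) (?B (Suc r))"
    have \<upsilon>X: "\<upsilon> \<in> simplices (d - 1) X"
      using \<upsilon> nbhd_complex_subset[OF assms(1) \<sigma>, of d "Suc r"]
      by (auto simp: simplices_def simp del: nbhd_complex.simps)
    have "\<upsilon> \<in> ?B (Suc r)" using \<upsilon> unfolding simplices_def by blast
    then show "\<upsilon> \<in> component_of d X \<sigma>"
    proof (cases rule: nbhd_complex_Suc_cases)
      case old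
      then show ?thesis using Suc \<upsilon> unfolding simplices_def by blast
    next
      case (new \<rho> \<tau>)
      have "\<tau> \<in> component_of d X \<sigma>"
        using Suc new unfolding simplices_def by blast
      moreover have "(\<tau>, \<upsilon>) \<in> adjacent d X"
        using new \<upsilon>X by (auto simp: adjacent_def faces_def)
      ultimately show ?thesis
        using \<upsilon>X by (auto simp: mem_component_of_iff intro: rtrancl_into_rtrancl)
    qed
  qed
qed

text \<open>A neighborhood that gains no \<open>(d - 1)\<close>-simplex in one step is closed under adjacency, hence
  has swallowed the whole component.\<close>

lemma component_subset_stable_nbhd:
  assumes "simplicial_complex X" "\<sigma> \<in> simplices (d - 1) X"
    and stable: "simplices (d - 1) (nbhd_complex d X \<sigma> (Suc r)) = simplices (d - 1) (nbhd_complex d X \<sigma> r)"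
  shows "component_of d X \<sigma> \<subseteq> simplices (d - 1) (nbhd_complex d X \<sigma> r)"
proof
  fix \<tau> assume "\<tau> \<in> component_of d X \<sigma>"
  then have "(\<sigma>, \<tau>) \<in> (adjacent d X)\<^sup>*"
    by (simp add: mem_component_of_iff)
  then show "\<tau> \<in> simplices (d - 1) (nbhd_complex d X \<sigma> r)"
  proof induction
    case base
    show ?case using root_in_nbhd_complex[OF assms(2)] .
  next
    case (step \<tau> \<upsilon>)
    from step.hyps(2) obtain \<rho> where \<rho>: "\<rho> \<in> simplices d X" "\<tau> \<subseteq> \<rho>" "\<upsilon> \<subseteq> \<rho>"
      and "\<tau> \<in> simplices (d - 1) X" and \<upsilon>: "\<upsilon> \<in> simplices (d - 1) X"
      by (auto simp: adjacent_def)
    then have "faces \<rho> \<subseteq> nbhd_complex d X \<sigma> (Suc r)"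
      using step.IH assms(1,2)
      by (intro faces_subset_nbhd_complex_Suc[of X \<sigma> \<tau>]) (auto simp: simplices_def)
    moreover have "\<upsilon> \<in> faces \<rho>"
      using \<rho> \<upsilon> by (auto simp: faces_def simplices_def)
    ultimately have "\<upsilon> \<in> simplices (d - 1) (nbhd_complex d X \<sigma> (Suc r))"
      using \<upsilon> unfolding simplices_def by blast
    then show ?case using stable by simp
  qed
qed

text \<open>Until it stabilizes, a neighborhood gains a \<open>(d - 1)\<close>-simplex at every step, so at radius \<open>k\<close>
  it has more than \<open>k\<close> of them or is complete. This makes the event that the component has at most
  \<open>k\<close> elements visible at radius \<open>k\<close>.\<close>

lemma card_nbhd_le_iff_component:
  fixes k :: nat
  assumes "(X, \<sigma>) \<in> rooted_complexes d"
  defines "S \<equiv> simplices (d - 1) (nbhd_complex d X \<sigma> k)"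
  shows "card S \<le> k \<longleftrightarrow> finite (component_of d X \<sigma>) \<and> card (component_of d X \<sigma>) \<le> k"
    and "card S \<le> k \<Longrightarrow> S = component_of d X \<sigma>"
proof -
  note X = rooted_complexesD[OF assms(1)]
  let ?S = "\<lambda>r. simplices (d - 1) (nbhd_complex d X \<sigma> r)"
  let ?C = "component_of d X \<sigma>"
  have sub: "?S r \<subseteq> ?C" for r
    by (rule simplices_nbhd_complex_subset_component[OF X(1,2)])
  have mono: "?S r \<subseteq> ?S s" if "r \<le> s" for r s
    using nbhd_complex_mono[OF that, of d X \<sigma>] by (auto simp: simplices_def)
  have fin: "finite (?S r)" for r
    using finite_nbhd_complex[OF assms(1)] by (simp add: simplices_def)
  have grow: "r < card (?S r) \<or> ?S r = ?C" for r
  proof (induction r)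
    case 0
    have "\<sigma> \<in> ?S 0" using root_in_nbhd_complex[OF X(2)] .
    then show ?case using fin[of 0] by (metis card_gt_0_iff empty_iff)
  next
    case (Suc r)
    have le: "?S r \<subseteq> ?S (Suc r)" by (rule mono) simp
    show ?case
    proof (cases "?S r = ?C")
      case True
      then show ?thesis using le sub[of "Suc r"] by auto
    next
      case False
      then have "?S (Suc r) \<noteq> ?S r"
        using component_subset_stable_nbhd[OF X(1,2), of r] sub[of r] by blast
      then have "card (?S r) < card (?S (Suc r))"
        using le fin[of "Suc r"] psubset_card_mono[of "?S (Suc r)" "?S r"] by blast
      then show ?thesis using Suc False by linarith
    qed
  qed
  show eq: "S = ?C" if "card S \<le> k"
    using that grow[of k] by (auto simp: S_def)
  show "card S \<le> k \<longleftrightarrow> finite ?C \<and> card ?C \<le> k"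
  proof
    assume "card S \<le> k"
    then show "finite ?C \<and> card ?C \<le> k"
      using eq fin[of k] by (auto simp: S_def)
  next
    assume "finite ?C \<and> card ?C \<le> k"
    then show "card S \<le> k"
      using card_mono[OF _ sub[of k]] by (auto simp: S_def)
  qed
qed

lemma Union_nbhd_complex_subset:
  assumes "d \<ge> 1" "\<sigma> \<in> simplices (d - 1) X"
  shows "\<Union>(nbhd_complex d X \<sigma> r) \<subseteq> \<Union>(simplices (d - 1) (nbhd_complex d X \<sigma> r))"
proof (induction r)
  case 0
  show ?case
    using mem_faces_self[OF assms(2)] assms(2) by (auto simp: faces_def simplices_def)
next
  case (Suc r)
  let ?B = "nbhd_complex d X \<sigma>"
  show ?case
  proof
    fix x assume "x \<in> \<Union>(?B (Suc r))"
    then obtain \<upsilon> where \<upsilon>: "x \<in> \<upsilon>" "\<upsilon> \<in> ?B (Suc r)" by blast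
    from \<upsilon>(2) show "x \<in> \<Union>(simplices (d - 1) (?B (Suc r)))"
    proof (cases rule: nbhd_complex_Suc_cases)
      case old
      then have "x \<in> \<Union>(simplices (d - 1) (?B r))" using Suc \<upsilon>(1) by blast
      then show ?thesis by (auto simp: simplices_def)
    next
      case (new \<rho>)
      have x: "x \<in> \<rho>" using new(2) \<upsilon>(1) by (auto simp: faces_def)
      have fin: "finite \<rho>" using simplex_finite new(1) .
      have card: "card \<rho> = d + 1" using new(1) by (simp add: simplices_def)
      then have "card (\<rho> - {x}) \<noteq> 0" using x fin assms(1) by simp
      then obtain y where y: "y \<in> \<rho>" "y \<noteq> x"
        by (metis DiffE card.empty ex_in_conv singletonI)
      \<comment> \<open>Drop a vertex other than \<open>x\<close> from the \<open>d\<close>-simplex; this is where \<open>d \<ge> 1\<close> enters.\<close>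
      have "\<rho> - {y} \<in> faces \<rho>" using y x by (auto simp: faces_def)
      moreover have "card (\<rho> - {y}) = d" using card y fin by simp
      ultimately have "\<rho> - {y} \<in> simplices (d - 1) (?B (Suc r))"
        using new(3) assms(1) unfolding simplices_def by auto
      then show ?thesis using y x by blast
    qed
  qed
qed

text \<open>A bound on the number of \<open>(d - 1)\<close>-simplices bounds the number of vertices, so it leaves only
  finitely many isomorphism types of neighborhoods.\<close>

lemma card_vertices_nbhd_complex_le:
  assumes "(X, \<sigma>) \<in> rooted_complexes d" "d \<ge> 1"
  shows "card (\<Union>(nbhd_complex d X \<sigma> r)) \<le> d * card (simplices (d - 1) (nbhd_complex d X \<sigma> r))"
proof -
  let ?S = "simplices (d - 1) (nbhd_complex d X \<sigma> r)"
  have fin: "finite ?S"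
    using finite_nbhd_complex[OF assms(1)] by (simp add: simplices_def)
  have "card (\<Union>(nbhd_complex d X \<sigma> r)) \<le> card (\<Union>?S)"
    using fin Union_nbhd_complex_subset[OF assms(2) rooted_complexesD(2)[OF assms(1)]]
    by (intro card_mono) (auto dest: simplex_finite)
  also have "\<dots> \<le> (\<Sum>\<tau>\<in>?S. card \<tau>)"
    using card_Union_le_sum_card by blast
  also have "\<dots> = d * card ?S"
    using assms(2) by (simp add: simplices_def)
  finally show ?thesis .
qed

lemma finite_complex_rooted:
  assumes "simplicial_complex Y" "finite Y" "\<tau> \<in> simplices (d - 1) Y"
  shows "(Y, \<tau>) \<in> rooted_complexes d"
  using assms
  by (auto simp: rooted_complexes_def locally_finite_above_def simplices_def)

lemma nbhd_rooted:
  assumes "(X, \<sigma>) \<in> rooted_complexes d"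
  shows "nbhd d (X, \<sigma>) r \<in> rooted_complexes d"
  unfolding nbhd_def fst_conv snd_conv
proof (rule finite_complex_rooted)
  note X = rooted_complexesD[OF assms]
  show "simplicial_complex (nbhd_complex d X \<sigma> r)"
    using X by (intro simplicial_complex_nbhd_complex) (auto simp: simplices_def)
  show "finite (nbhd_complex d X \<sigma> r)" by (rule finite_nbhd_complex[OF assms])
  show "\<sigma> \<in> simplices (d - 1) (nbhd_complex d X \<sigma> r)"
    by (rule root_in_nbhd_complex[OF X(2)])
qed


section \<open>Isomorphism classes\<close>

lemma complex_iso_map_id: "complex_iso_map id X X"
  by (simp add: complex_iso_map_def)

lemma complex_iso_map_comp:
  assumes "complex_iso_map f X Y" "complex_iso_map g Y Z"
  shows "complex_iso_map (g \<circ> f) X Z"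
proof -
  have "\<sigma> \<in> X \<longleftrightarrow> (g \<circ> f) ` \<sigma> \<in> Z" if "\<sigma> \<subseteq> \<Union>X" for \<sigma>
  proof -
    have "f ` \<sigma> \<subseteq> \<Union>Y"
      using assms(1) that unfolding complex_iso_map_def bij_betw_def by (metis image_mono)
    then show ?thesis
      using assms that by (simp add: complex_iso_map_def image_image)
  qed
  then show ?thesis
    using assms by (auto simp: complex_iso_map_def intro: bij_betw_trans)
qed

lemma complex_iso_map_inv:
  assumes "complex_iso_map f X Y"
  shows "complex_iso_map (inv_into (\<Union>X) f) Y X"
proof -
  let ?g = "inv_into (\<Union>X) f"
  have f: "bij_betw f (\<Union>X) (\<Union>Y)" and iff: "\<And>\<sigma>. \<sigma> \<subseteq> \<Union>X \<Longrightarrow> \<sigma> \<in> X \<longleftrightarrow> f ` \<sigma> \<in> Y"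
    using assms by (auto simp: complex_iso_map_def)
  have g: "bij_betw ?g (\<Union>Y) (\<Union>X)"
    using f by (rule bij_betw_inv_into)
  have "\<tau> \<in> Y \<longleftrightarrow> ?g ` \<tau> \<in> X" if \<tau>: "\<tau> \<subseteq> \<Union>Y" for \<tau>
  proof -
    have "?g ` \<tau> \<subseteq> \<Union>X"
      using g \<tau> unfolding bij_betw_def by (metis image_mono)
    moreover have "f ` ?g ` \<tau> = \<tau>"
      using f \<tau> by (intro image_inv_into_cancel) (auto simp: bij_betw_def)
    ultimately show ?thesis
      using iff[of "?g ` \<tau>"] by simp
  qed
  with g show ?thesis
    by (simp add: complex_iso_map_def)
qed

lemma rooted_iso_refl: "rooted_iso p p"
  unfolding rooted_iso_def using complex_iso_map_id by (metis image_id id_apply)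

lemma rooted_iso_trans: "rooted_iso p q \<Longrightarrow> rooted_iso q s \<Longrightarrow> rooted_iso p s"
  unfolding rooted_iso_def using complex_iso_map_comp by (metis image_comp)

lemma rooted_iso_sym:
  assumes "rooted_iso p q" "snd p \<subseteq> \<Union>(fst p)"
  shows "rooted_iso q p"
proof -
  obtain f where f: "complex_iso_map f (fst p) (fst q)" "f ` snd p = snd q"
    using assms(1) by (auto simp: rooted_iso_def)
  have "inv_into (\<Union>(fst p)) f ` snd q = snd p"
    using f assms(2) unfolding complex_iso_map_def bij_betw_def
    by (metis inv_into_image_cancel)
  then show ?thesis
    using complex_iso_map_inv[OF f(1)] by (auto simp: rooted_iso_def)
qed

lemma card_simplices_rooted_iso:
  assumes "rooted_iso p q"
  shows "card (simplices k (fst p)) = card (simplices k (fst q))"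
proof -
  obtain f where f: "bij_betw f (\<Union>(fst p)) (\<Union>(fst q))"
    and iff: "\<And>\<sigma>. \<sigma> \<subseteq> \<Union>(fst p) \<Longrightarrow> \<sigma> \<in> fst p \<longleftrightarrow> f ` \<sigma> \<in> fst q"
    using assms by (auto simp: rooted_iso_def complex_iso_map_def)
  have inj: "inj_on f (\<Union>(fst p))" using f by (simp add: bij_betw_def)
  have card: "card (f ` \<sigma>) = card \<sigma>" if "\<sigma> \<subseteq> \<Union>(fst p)" for \<sigma>
    using inj_on_subset[OF inj that] by (rule card_image)
  have "bij_betw ((`) f) (simplices k (fst p)) (simplices k (fst q))"
    unfolding bij_betw_def
  proof
    show "inj_on ((`) f) (simplices k (fst p))"
      by (rule inj_on_subset[OF inj_on_image_Pow[OF inj]]) (auto simp: simplices_def)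
    show "(`) f ` simplices k (fst p) = simplices k (fst q)"
    proof (intro equalityI subsetI)
      fix \<tau> assume "\<tau> \<in> (`) f ` simplices k (fst p)"
      then obtain \<sigma> where \<sigma>: "\<sigma> \<in> simplices k (fst p)" "\<tau> = f ` \<sigma>" by blast
      then have "\<sigma> \<subseteq> \<Union>(fst p)" by (auto simp: simplices_def)
      then show "\<tau> \<in> simplices k (fst q)"
        using \<sigma> iff card by (auto simp: simplices_def)
    next
      fix \<tau> assume \<tau>: "\<tau> \<in> simplices k (fst q)"
      then have "\<tau> \<subseteq> f ` \<Union>(fst p)" using f by (auto simp: simplices_def bij_betw_def)
      then obtain \<sigma> where \<sigma>: "\<sigma> \<subseteq> \<Union>(fst p)" "\<tau> = f ` \<sigma>" by (metis subset_imageE)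
      then show "\<tau> \<in> (`) f ` simplices k (fst p)"
        using \<tau> iff card by (auto simp: simplices_def)
    qed
  qed
  then show ?thesis by (rule bij_betw_same_card)
qed

text \<open>Push the complex forward along an injection of its vertices into \<open>V\<close>. With \<open>V\<close> fixed, there are
  only finitely many candidates for the copy, which is what makes the set of small classes finite.\<close>

lemma rooted_iso_copy:
  fixes p :: "'a rooted" and V :: "'v set"
  assumes "p \<in> rooted_complexes d" "finite (\<Union>(fst p))" "finite V" "card (\<Union>(fst p)) \<le> card V"
  shows "\<exists>q \<in> rooted_complexes d \<inter> Pow (Pow V) \<times> Pow V. rooted_iso p q"
proof -
  obtain Y \<tau> where p: "p = (Y, \<tau>)" by (cases p)
  obtain f where f: "f ` \<Union>Y \<subseteq> V" "inj_on f (\<Union>Y)"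
    using assms(2-4) card_le_inj[of "\<Union>Y" V] by (auto simp: p)
  note Y = rooted_complexesD[OF assms(1)[unfolded p]]
  have finY: "finite Y" using assms(2) by (simp add: p finite_UnionD)
  define Z where "Z = (`) f ` Y"
  have UZ: "\<Union>Z = f ` \<Union>Y" by (auto simp: Z_def)
  have iff: "\<sigma> \<in> Y \<longleftrightarrow> f ` \<sigma> \<in> Z" if "\<sigma> \<subseteq> \<Union>Y" for \<sigma>
  proof
    assume "f ` \<sigma> \<in> Z"
    then obtain \<upsilon> where "\<upsilon> \<in> Y" "f ` \<sigma> = f ` \<upsilon>" by (auto simp: Z_def)
    then show "\<sigma> \<in> Y"
      using inj_on_image_eq_iff[OF f(2) that, of \<upsilon>] by auto
  qed (auto simp: Z_def)
  have iso: "rooted_iso p (Z, f ` \<tau>)"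
    unfolding rooted_iso_def complex_iso_map_def using f(2) iff
    by (auto simp: p UZ bij_betw_def intro!: exI[of _ f])
  have "(Z, f ` \<tau>) \<in> rooted_complexes d"
  proof (rule finite_complex_rooted)
    show "finite Z" using finY by (simp add: Z_def)
    show "simplicial_complex Z"
      unfolding simplicial_complex_def Z_def
    proof (intro ballI conjI allI impI)
      fix \<sigma> \<upsilon> assume "\<sigma> \<in> (`) f ` Y" and \<upsilon>: "\<upsilon> \<subseteq> \<sigma> \<and> \<upsilon> \<noteq> {}"
      then obtain \<rho> where \<rho>: "\<rho> \<in> Y" "\<sigma> = f ` \<rho>" by blast
      with \<upsilon> obtain \<pi> where "\<pi> \<subseteq> \<rho>" "\<upsilon> = f ` \<pi>" by (metis subset_imageE)
      then have "\<pi> \<in> Y"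
        using \<rho>(1) \<upsilon> Y(1) unfolding simplicial_complex_def by blast
      then show "\<upsilon> \<in> (`) f ` Y" using \<open>\<upsilon> = f ` \<pi>\<close> by blast
    qed (use Y(1) in \<open>auto simp: simplicial_complex_def\<close>)
    have "\<tau> \<in> Y" using Y(2) by (simp add: simplices_def)
    then have "card (f ` \<tau>) = card \<tau>"
      using f(2) by (intro card_image) (auto intro: inj_on_subset)
    then show "f ` \<tau> \<in> simplices (d - 1) Z"
      using Y(2) by (auto simp: simplices_def Z_def)
  qed
  moreover have "(Z, f ` \<tau>) \<in> Pow (Pow V) \<times> Pow V"
  proof -
    have "f ` \<tau> \<subseteq> V" using f(1) Y(2) by (auto simp: simplices_def)
    moreover have "\<Union>Z \<subseteq> V" using f(1) by (simp only: UZ)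
    ultimately show ?thesis by auto
  qed
  ultimately show ?thesis using iso by blast
qed

lemma root_subset_vertices: "p \<in> rooted_complexes d \<Longrightarrow> snd p \<subseteq> \<Union>(fst p)"
  by (auto simp: rooted_complexes_def simplices_def)

lemma rooted_classes_iff:
  fixes H :: "'v rooted set"
  shows "H \<in> rooted_classes d \<longleftrightarrow>
     (\<exists>p\<in>rooted_complexes d :: 'v rooted set. H = {q \<in> rooted_complexes d. rooted_iso p q})"
proof -
  let ?r = "{(p :: 'v rooted, q :: 'v rooted). p \<in> rooted_complexes d \<and> q \<in> rooted_complexes d \<and> rooted_iso p q}"
  have "?r `` {p} = {q \<in> rooted_complexes d. rooted_iso p q}" if "p \<in> rooted_complexes d"
    for p :: "'v rooted"
    using that by blast
  then show ?thesis
    unfolding rooted_classes_def quotient_def by auto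
qed

lemma rooted_class_eq:
  fixes H :: "'v rooted set"
  assumes "H \<in> rooted_classes d" "q \<in> H"
  shows "q \<in> rooted_complexes d" "H = {s \<in> rooted_complexes d. rooted_iso q s}"
proof -
  obtain p :: "'v rooted" where p: "p \<in> rooted_complexes d" and H: "H = {s \<in> rooted_complexes d. rooted_iso p s}"
    using assms(1) unfolding rooted_classes_iff by blast
  then show "q \<in> rooted_complexes d" using assms(2) by blast
  have "rooted_iso p q" using assms(2) H by blast
  moreover have "rooted_iso q p"
    using calculation root_subset_vertices[OF p] by (rule rooted_iso_sym)
  ultimately have "rooted_iso p s \<longleftrightarrow> rooted_iso q s" for s :: "'v rooted"
    using rooted_iso_trans by blast
  then show "H = {s \<in> rooted_complexes d. rooted_iso q s}" by (simp add: H)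
qed

lemma rep_mem:
  assumes "c \<in> rooted_classes d"
  shows "rep c \<in> c"
proof -
  obtain p where "p \<in> c"
    using assms rooted_iso_refl unfolding rooted_classes_iff by blast
  then show ?thesis unfolding rep_def by (rule someI)
qed

lemma rep_rooted: "c \<in> rooted_classes d \<Longrightarrow> rep c \<in> rooted_complexes d"
  using rooted_class_eq(1) rep_mem by blast

lemma in_iso_class_iff:
  assumes "H \<in> rooted_classes d"
  shows "in_iso_class p H \<longleftrightarrow> rooted_iso p (rep H)"
proof
  assume "in_iso_class p H"
  then obtain q where q: "q \<in> H" "rooted_iso p q" by (auto simp: in_iso_class_def)
  then have "rooted_iso q (rep H)"
    using rooted_class_eq(2)[OF assms q(1)] rep_mem[OF assms] by blast
  with q(2) show "rooted_iso p (rep H)" by (rule rooted_iso_trans)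
qed (use rep_mem[OF assms] in \<open>auto simp: in_iso_class_def\<close>)

lemma in_iso_class_unique:
  assumes "H \<in> rooted_classes d" "H' \<in> rooted_classes d" "p \<in> rooted_complexes d"
    "in_iso_class p H" "in_iso_class p H'"
  shows "H = H'"
proof -
  have "rooted_iso (rep H) (rep H')"
    using assms in_iso_class_iff root_subset_vertices rooted_iso_sym rooted_iso_trans by metis
  then have "rep H' \<in> H"
    using rooted_class_eq(2)[OF assms(1) rep_mem[OF assms(1)]] rep_rooted[OF assms(2)] by blast
  then show ?thesis
    using rooted_class_eq(2)[OF assms(1)] rooted_class_eq(2)[OF assms(2) rep_mem[OF assms(2)]]
    by blast
qed

text \<open>As the count of \<open>(d - 1)\<close>-simplices is invariant under isomorphism, \<open>class_size\<close> can be read off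
  any member; \<open>small_classes\<close> contains the classes on which the truncated weight can be nonzero at
  radius \<open>k\<close>.\<close>

definition class_size :: "nat \<Rightarrow> 'v rooted set \<Rightarrow> nat" where
  "class_size d H = card (simplices (d - 1) (fst (rep H)))"

definition small_classes :: "nat \<Rightarrow> nat \<Rightarrow> 'v rooted set set" where
  "small_classes d k = {H \<in> rooted_classes d. class_size d H \<le> k \<and>
     (\<exists>q\<in>H. finite (\<Union>(fst q)) \<and> card (\<Union>(fst q)) \<le> d * k)}"

lemma small_classes_subset: "small_classes d k \<subseteq> rooted_classes d"
  by (auto simp: small_classes_def)

lemma class_size_eq:
  assumes "H \<in> rooted_classes d" "in_iso_class p H"
  shows "class_size d H = card (simplices (d - 1) (fst p))"
  using assms card_simplices_rooted_iso[of p "rep H"] by (simp add: class_size_def in_iso_class_iff)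

lemma finite_small_classes:
  assumes "infinite (UNIV :: 'v set)"
  shows "finite (small_classes d k :: 'v rooted set set)"
proof -
  obtain V :: "'v set" where V: "finite V" "card V = d * k"
    using infinite_arbitrarily_large[OF assms] by blast
  let ?cls = "\<lambda>p :: 'v rooted. {q \<in> rooted_complexes d :: 'v rooted set. rooted_iso p q}"
  have "small_classes d k \<subseteq> ?cls ` (Pow (Pow V) \<times> Pow V)"
  proof
    fix H :: "'v rooted set" assume "H \<in> small_classes d k"
    then obtain q where H: "H \<in> rooted_classes d"
      and q: "q \<in> H" "finite (\<Union>(fst q))" "card (\<Union>(fst q)) \<le> card V"
      by (auto simp: small_classes_def V)
    obtain s where s: "s \<in> rooted_complexes d" "s \<in> Pow (Pow V) \<times> Pow V" "rooted_iso q s"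
      using rooted_iso_copy[OF rooted_class_eq(1)[OF H q(1)] q(2) V(1) q(3)] by blast
    then have "s \<in> H" using rooted_class_eq(2)[OF H q(1)] by blast
    then show "H \<in> ?cls ` (Pow (Pow V) \<times> Pow V)"
      using rooted_class_eq(2)[OF H] s(2) by blast
  qed
  then show ?thesis
    using V(1) by (meson finite_Pow_iff finite_SigmaI finite_imageI finite_subset)
qed

lemma small_class_exists:
  fixes p :: "'a rooted"
  assumes "infinite (UNIV :: 'v set)" "p \<in> rooted_complexes d" "finite (\<Union>(fst p))"
    "card (\<Union>(fst p)) \<le> d * k" "card (simplices (d - 1) (fst p)) \<le> k"
  shows "\<exists>H \<in> (small_classes d k :: 'v rooted set set). in_iso_class p H"
proof -
  obtain V :: "'v set" where V: "finite V" "card V = d * k"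
    using infinite_arbitrarily_large[OF assms(1)] by blast
  obtain q where q: "q \<in> rooted_complexes d" "q \<in> Pow (Pow V) \<times> Pow V" "rooted_iso p q"
    using rooted_iso_copy[OF assms(2,3) V(1)] assms(4) V(2) by auto
  define H :: "'v rooted set" where "H = {s \<in> rooted_complexes d. rooted_iso q s}"
  have H: "H \<in> rooted_classes d" using q(1) by (auto simp: rooted_classes_iff H_def)
  have qH: "q \<in> H" using q(1) by (simp add: H_def rooted_iso_refl)
  have pH: "in_iso_class p H" using qH q(3) by (auto simp: in_iso_class_def)
  have "\<Union>(fst q) \<subseteq> V" using q(2) by auto
  then have "finite (\<Union>(fst q)) \<and> card (\<Union>(fst q)) \<le> d * k"
    using V by (metis card_mono finite_subset)
  then have "H \<in> small_classes d k"
    using H qH class_size_eq[OF H pH] assms(5) by (auto simp: small_classes_def)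
  then show ?thesis using pH by blast
qed


section \<open>The truncated inverse component size\<close>

definition inv_size :: "nat \<Rightarrow> 'v rooted \<Rightarrow> real" where
  "inv_size d p = (let C = component_of d (fst p) (snd p)
     in if finite C then 1 / real (card C) else 0)"

definition trunc_inv_size :: "nat \<Rightarrow> nat \<Rightarrow> 'v rooted \<Rightarrow> real" where
  "trunc_inv_size d k p = (let C = component_of d (fst p) (snd p)
     in if finite C \<and> card C \<le> k then 1 / real (card C) else 0)"

lemma inv_component_size_eq: "inv_component_size d c = inv_size d (rep c)"
  by (simp add: inv_component_size_def inv_size_def)

lemma abs_inv_size_le_1: "\<bar>inv_size d p\<bar> \<le> 1"
  by (cases "card (component_of d (fst p) (snd p))") (auto simp: inv_size_def Let_def)

lemma trunc_inv_size_approx: "\<bar>inv_size d p - trunc_inv_size d k p\<bar> \<le> 1 / real (Suc k)"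
  by (auto simp: inv_size_def trunc_inv_size_def Let_def intro!: divide_left_mono)

text \<open>If the component has at most \<open>k\<close> elements, the neighborhood of radius \<open>k\<close> contains it and falls
  into exactly one small class, whose size is that of the component. Otherwise the neighborhood has
  more than \<open>k\<close> elements of the component and falls into none.\<close>

lemma trunc_inv_size_eq_sum:
  fixes p :: "'a rooted"
  assumes "infinite (UNIV :: 'v set)" "d \<ge> 1" "p \<in> rooted_complexes d"
  shows "trunc_inv_size d k p = (\<Sum>H\<in>(small_classes d k :: 'v rooted set set).
           1 / real (class_size d H) * of_bool (in_iso_class (nbhd d p k) H))"
proof -
  obtain X \<sigma> where p: "p = (X, \<sigma>)" by (cases p)
  let ?B = "nbhd d p k"
  let ?F = "small_classes d k :: 'v rooted set set"
  note rc = assms(3)[unfolded p]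
  have B: "?B \<in> rooted_complexes d" using nbhd_rooted[OF rc] by (simp add: p)
  have fst_B: "fst ?B = nbhd_complex d X \<sigma> k" by (simp add: nbhd_def p)
  note comp = card_nbhd_le_iff_component[OF rc, of k]
  show ?thesis
  proof (cases "card (simplices (d - 1) (fst ?B)) \<le> k")
    case True
    have "card (\<Union>(fst ?B)) \<le> d * card (simplices (d - 1) (fst ?B))"
      using card_vertices_nbhd_complex_le[OF rc assms(2)] by (simp add: fst_B)
    also have "\<dots> \<le> d * k" using True by simp
    finally have "card (\<Union>(fst ?B)) \<le> d * k" .
    moreover have "finite (\<Union>(fst ?B))"
      using finite_nbhd_complex[OF rc, of k] B unfolding fst_B[symmetric]
      by (intro finite_Union) (auto simp: rooted_complexes_def simplicial_complex_def)
    ultimately obtain H where H: "H \<in> ?F" "in_iso_class ?B H"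
      using small_class_exists[OF assms(1) B _ _ True] by blast
    have uniq: "in_iso_class ?B H' \<longleftrightarrow> H' = H" if "H' \<in> ?F" for H'
      using in_iso_class_unique[of H' d H ?B] H that B small_classes_subset by blast
    have "(\<Sum>H'\<in>?F. 1 / real (class_size d H') * of_bool (in_iso_class ?B H'))
        = (\<Sum>H'\<in>?F. if H' = H then 1 / real (class_size d H) else 0)"
      by (rule sum.cong) (auto simp: uniq)
    also have "\<dots> = 1 / real (class_size d H)"
      using H(1) finite_small_classes[OF assms(1)] by simp
    also have "class_size d H = card (component_of d X \<sigma>)"
      using class_size_eq[OF _ H(2), of d] H(1) small_classes_subset[of d k] comp(2) True
      by (auto simp: fst_B)
    finally show ?thesis
      using comp(1) True by (simp add: trunc_inv_size_def p[symmetric] fst_B) (simp add: p)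
  next
    case False
    have "\<not> in_iso_class ?B H" if "H \<in> ?F" for H
      using class_size_eq[of H d ?B] that False by (auto simp: small_classes_def)
    then show ?thesis
      using comp(1) False unfolding fst_B by (auto simp: trunc_inv_size_def Let_def p)
  qed
qed

lemma component_density_eq:
  assumes "finite X"
  shows "real (card (d_components d X)) / real (card (simplices (d - 1) X))
     = 1 / real (card (simplices (d - 1) X)) * (\<Sum>\<sigma>\<in>simplices (d - 1) X. inv_size d (X, \<sigma>))"
proof -
  have fin: "finite (simplices (d - 1) X)"
    using assms by (simp add: simplices_def)
  have "finite (component_of d X \<sigma>)" for \<sigma>
    by (rule finite_subset[OF _ fin]) (auto simp: mem_component_of_iff)
  then have "inv_size d (X, \<sigma>) = 1 / real (card (connected_rel d X `` {\<sigma>}))" for \<sigma>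
    by (simp add: inv_size_def component_of_def)
  then show ?thesis
    using card_quotient_eq_sum[OF fin equiv_connected_rel] by (simp add: d_components_def)
qed

lemma component_density_approx:
  fixes X :: "'a scomplex"
  assumes "infinite (UNIV :: 'v set)" "d \<ge> 1" "finite X" "simplicial_complex X"
  shows "\<bar>real (card (d_components d X)) / real (card (simplices (d - 1) X))
      - (\<Sum>H\<in>(small_classes d k :: 'v rooted set set). 1 / real (class_size d H) * nbhd_fraction d X k H)\<bar>
     \<le> 1 / real (Suc k)"
proof -
  let ?S = "simplices (d - 1) X"
  let ?F = "small_classes d k :: 'v rooted set set"
  have fin: "finite ?S" using assms(3) by (simp add: simplices_def)
  have "(\<Sum>H\<in>?F. 1 / real (class_size d H) * nbhd_fraction d X k H)
      = 1 / real (card ?S) * (\<Sum>H\<in>?F. \<Sum>\<sigma>\<in>?S.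
          1 / real (class_size d H) * of_bool (in_iso_class (nbhd d (X, \<sigma>) k) H))"
    by (simp add: nbhd_fraction_def sum_distrib_left mult_ac)
  also have "(\<Sum>H\<in>?F. \<Sum>\<sigma>\<in>?S.
          1 / real (class_size d H) * of_bool (in_iso_class (nbhd d (X, \<sigma>) k) H))
      = (\<Sum>\<sigma>\<in>?S. trunc_inv_size d k (X, \<sigma>))"
    unfolding sum.swap[of _ ?S ?F] using assms finite_complex_rooted
    by (intro sum.cong trunc_inv_size_eq_sum[symmetric]) blast+
  finally have "real (card (d_components d X)) / real (card ?S)
      - (\<Sum>H\<in>?F. 1 / real (class_size d H) * nbhd_fraction d X k H)
      = 1 / real (card ?S) * (\<Sum>\<sigma>\<in>?S. inv_size d (X, \<sigma>) - trunc_inv_size d k (X, \<sigma>))"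
    unfolding component_density_eq[OF assms(3)] by (simp add: sum_subtractf diff_divide_distrib)
  moreover have "\<bar>\<Sum>\<sigma>\<in>?S. inv_size d (X, \<sigma>) - trunc_inv_size d k (X, \<sigma>)\<bar>
      \<le> real (card ?S) * (1 / real (Suc k))"
    by (rule order_trans[OF sum_abs]) (rule sum_bounded_above, rule trunc_inv_size_approx)
  ultimately show ?thesis
    by (cases "card ?S = 0") (auto simp: abs_mult field_simps)
qed

text \<open>The neighborhood events generate the \<open>\<sigma>\<close>-algebra, so the truncations are simple functions with
  integral a combination of the numbers \<open>nbhd_prob\<close>; their uniform limit \<open>inv_component_size\<close> is
  thereby measurable and bounded.\<close>

lemma expected_inv_size_approx:
  fixes \<nu> :: "'v rooted set measure"
  assumes "infinite (UNIV :: 'v set)" "d \<ge> 1" "prob_space \<nu>"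
    and sets_\<nu>: "sets \<nu> = sets (rooted_class_space d)"
  shows "\<bar>(\<integral>c. inv_component_size d c \<partial>\<nu>)
      - (\<Sum>H\<in>small_classes d k. 1 / real (class_size d H) * nbhd_prob d \<nu> k H)\<bar> \<le> 1 / real (Suc k)"
proof -
  interpret prob_space \<nu> by fact
  have space_\<nu>: "space \<nu> = rooted_classes d"
    using sets_eq_imp_space_eq[OF sets_\<nu>] by (simp add: rooted_class_space_def space_measure_of_conv)
  let ?E = "\<lambda>r (H :: 'v rooted set). {c \<in> space \<nu>. in_iso_class (nbhd d (rep c) r) H}"
  let ?w = "\<lambda>H :: 'v rooted set. 1 / real (class_size d H)"
  define g where "g k c = (\<Sum>H\<in>small_classes d k. ?w H * indicator (?E k H) c)"
    for k and c :: "'v rooted set"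
  have E: "?E r H \<in> sets \<nu>" if "H \<in> rooted_classes d" for r H
  proof -
    have "?E r H \<in> {{c \<in> rooted_classes d. in_iso_class (nbhd d (rep c) r) H}
        |r H :: 'v rooted set. H \<in> rooted_classes d}"
      using that unfolding space_\<nu> by blast
    then show ?thesis
      unfolding sets_\<nu> rooted_class_space_def by (subst sets_measure_of) auto
  qed
  have g_eq: "g j c = trunc_inv_size d j (rep c)" if "c \<in> space \<nu>" for j c
    using that trunc_inv_size_eq_sum[OF assms(1,2), of "rep c" j] rep_rooted[of c d]
    by (auto simp: g_def space_\<nu> indicator_def intro!: sum.cong)
  have g_meas: "g j \<in> borel_measurable \<nu>" for j
    unfolding g_def using E small_classes_subset
    by (intro borel_measurable_sum borel_measurable_times borel_measurable_const
      borel_measurable_indicator) blast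
  have approx: "\<bar>inv_component_size d c - g j c\<bar> \<le> 1 / real (Suc j)" if "c \<in> space \<nu>" for j c
    using trunc_inv_size_approx[of d "rep c" j] g_eq[OF that] by (simp add: inv_component_size_eq)
  have f_meas: "inv_component_size d \<in> borel_measurable \<nu>"
  proof (rule borel_measurable_LIMSEQ_real)
    fix c assume c: "c \<in> space \<nu>"
    have "(\<lambda>j. g j c - inv_component_size d c) \<longlonglongrightarrow> 0"
    proof (rule Lim_null_comparison[OF _ LIMSEQ_inverse_real_of_nat])
      show "\<forall>\<^sub>F j in sequentially. norm (g j c - inv_component_size d c) \<le> inverse (real (Suc j))"
        using approx[OF c] by (simp add: abs_minus_commute inverse_eq_divide)
    qed
    then show "(\<lambda>j. g j c) \<longlonglongrightarrow> inv_component_size d c"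
      by (simp add: LIM_zero_iff)
  qed (rule g_meas)
  have f_int: "integrable \<nu> (inv_component_size d)"
    by (rule integrable_const_bound[of _ 1])
      (use f_meas in \<open>auto simp: inv_component_size_eq abs_inv_size_le_1\<close>)
  have h_int: "integrable \<nu> (\<lambda>c. ?w H * indicator (?E k H) c)" if "H \<in> small_classes d k" for H
    using E[OF subsetD[OF small_classes_subset that]] emeasure_finite
    by (intro integrable_mult_right integrable_real_indicator) (auto simp: less_top[symmetric])
  have g_int: "integrable \<nu> (g k)"
    unfolding g_def using h_int by (rule Bochner_Integration.integrable_sum)
  have "(\<integral>c. g k c \<partial>\<nu>) = (\<Sum>H\<in>small_classes d k. \<integral>c. ?w H * indicator (?E k H) c \<partial>\<nu>)"
    unfolding g_def using h_int by (rule Bochner_Integration.integral_sum)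
  also have "\<dots> = (\<Sum>H\<in>small_classes d k. ?w H * nbhd_prob d \<nu> k H)"
    by (intro sum.cong refl) (simp add: nbhd_prob_def Int_absorb2)
  finally have "\<bar>(\<integral>c. inv_component_size d c \<partial>\<nu>)
      - (\<Sum>H\<in>small_classes d k. ?w H * nbhd_prob d \<nu> k H)\<bar>
      = \<bar>\<integral>c. inv_component_size d c - g k c \<partial>\<nu>\<bar>"
    using f_int g_int by simp
  also have "\<dots> \<le> (\<integral>c. \<bar>inv_component_size d c - g k c\<bar> \<partial>\<nu>)"
    by (rule integral_abs_bound)
  also have "\<dots> \<le> (\<integral>c. 1 / real (Suc k) \<partial>\<nu>)"
    using f_int g_int approx by (intro integral_mono) auto
  also have "\<dots> = 1 / real (Suc k)"
    by (simp add: prob_space)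
  finally show ?thesis .
qed


section \<open>Convergence in probability\<close>

lemma converges_in_prob_const: "converges_in_prob M (\<lambda>n \<omega>. c) (\<lambda>\<omega>. c)"
  by (simp add: converges_in_prob_def)

lemma converges_in_prob_cmult:
  assumes "converges_in_prob M Y Z"
  shows "converges_in_prob M (\<lambda>n \<omega>. c * Y n \<omega>) (\<lambda>\<omega>. c * Z \<omega>)"
proof (cases "c = 0")
  case True
  then show ?thesis using converges_in_prob_const by simp
next
  case False
  have "\<bar>c * y - c * z\<bar> = \<bar>c\<bar> * \<bar>y - z\<bar>" for y z :: real
    by (metis abs_mult right_diff_distrib)
  then have scale: "\<bar>c * y - c * z\<bar> > \<epsilon> \<longleftrightarrow> \<bar>y - z\<bar> > \<epsilon> / \<bar>c\<bar>" for y z \<epsilon> :: real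
    using False by (metis mult.commute pos_divide_less_eq zero_less_abs_iff)
  show ?thesis
    unfolding converges_in_prob_def scale
  proof (intro conjI allI impI)
    fix \<epsilon> :: real assume "\<epsilon> > 0"
    then have "\<epsilon> / \<bar>c\<bar> > 0" using False by simp
    then show "(\<lambda>n. measure M {\<omega> \<in> space M. \<bar>Y n \<omega> - Z \<omega>\<bar> > \<epsilon> / \<bar>c\<bar>}) \<longlonglongrightarrow> 0"
      using assms unfolding converges_in_prob_def by blast
  qed (use assms in \<open>auto simp: converges_in_prob_def intro: borel_measurable_times\<close>)
qed

lemma (in prob_space) converges_in_prob_add:
  assumes "converges_in_prob M Y Z" "converges_in_prob M Y' Z'"
  shows "converges_in_prob M (\<lambda>n \<omega>. Y n \<omega> + Y' n \<omega>) (\<lambda>\<omega>. Z \<omega> + Z' \<omega>)"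
proof -
  have [measurable]: "\<And>n. Y n \<in> borel_measurable M" "\<And>n. Y' n \<in> borel_measurable M"
    "Z \<in> borel_measurable M" "Z' \<in> borel_measurable M"
    using assms by (auto simp: converges_in_prob_def)
  \<comment> \<open>One of two summands must deviate by more than \<open>\<epsilon> / 2\<close> if their sum deviates by more than \<open>\<epsilon>\<close>.\<close>
  have "(\<lambda>n. prob {\<omega> \<in> space M. \<bar>(Y n \<omega> + Y' n \<omega>) - (Z \<omega> + Z' \<omega>)\<bar> > \<epsilon>}) \<longlonglongrightarrow> 0"
    if "\<epsilon> > 0" for \<epsilon>
  proof (rule tendsto_sandwich[OF _ _ tendsto_const])
    let ?A = "\<lambda>n. {\<omega> \<in> space M. \<bar>Y n \<omega> - Z \<omega>\<bar> > \<epsilon> / 2}"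
    let ?B = "\<lambda>n. {\<omega> \<in> space M. \<bar>Y' n \<omega> - Z' \<omega>\<bar> > \<epsilon> / 2}"
    have "prob {\<omega> \<in> space M. \<bar>(Y n \<omega> + Y' n \<omega>) - (Z \<omega> + Z' \<omega>)\<bar> > \<epsilon>} \<le> prob (?A n \<union> ?B n)" for n
      by (rule finite_measure_mono) (auto simp: abs_if split: if_splits)
    also have "prob (?A n \<union> ?B n) \<le> prob (?A n) + prob (?B n)" for n
      by (rule measure_Un_le) measurable
    finally show "\<forall>\<^sub>F n in sequentially.
        prob {\<omega> \<in> space M. \<bar>(Y n \<omega> + Y' n \<omega>) - (Z \<omega> + Z' \<omega>)\<bar> > \<epsilon>} \<le> prob (?A n) + prob (?B n)"
      by simp
    have "\<epsilon> / 2 > 0" using that by simp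
    then show "(\<lambda>n. prob (?A n) + prob (?B n)) \<longlonglongrightarrow> 0"
      using assms unfolding converges_in_prob_def by (intro tendsto_add_zero) blast+
  qed simp
  then show ?thesis
    by (simp add: converges_in_prob_def)
qed

lemma (in prob_space) converges_in_prob_sum:
  assumes "finite I" "\<And>i. i \<in> I \<Longrightarrow> converges_in_prob M (Y i) (Z i)"
  shows "converges_in_prob M (\<lambda>n \<omega>. \<Sum>i\<in>I. Y i n \<omega>) (\<lambda>\<omega>. \<Sum>i\<in>I. Z i \<omega>)"
  using assms
  by (induction I rule: finite_induct) (simp_all add: converges_in_prob_const converges_in_prob_add)

text \<open>Uniform approximation transfers measurability, since \<open>Y n\<close> and \<open>Z\<close> are pointwise limits, and
  convergence: once \<open>\<delta> k < \<epsilon> / 3\<close>, a deviation of \<open>Y n\<close> from \<open>Z\<close> above \<open>\<epsilon>\<close> forces one of \<open>Yk k n\<close>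
  from \<open>Zk k\<close> above \<open>\<epsilon> / 3\<close>.\<close>

lemma (in prob_space) converges_in_prob_uniform_approx:
  assumes conv: "\<And>k. converges_in_prob M (Yk k) (Zk k)"
    and Y: "\<And>k n \<omega>. \<omega> \<in> space M \<Longrightarrow> \<bar>Y n \<omega> - Yk k n \<omega>\<bar> \<le> \<delta> k"
    and Z: "\<And>k \<omega>. \<omega> \<in> space M \<Longrightarrow> \<bar>Z \<omega> - Zk k \<omega>\<bar> \<le> \<delta> k"
    and \<delta>: "\<delta> \<longlonglongrightarrow> 0"
  shows "converges_in_prob M Y Z"
proof -
  have lim: "f \<in> borel_measurable M"
    if "\<And>k. fk k \<in> borel_measurable M" "\<And>k \<omega>. \<omega> \<in> space M \<Longrightarrow> \<bar>f \<omega> - fk k \<omega>\<bar> \<le> \<delta> k"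
    for f :: "_ \<Rightarrow> real" and fk
  proof (rule borel_measurable_LIMSEQ_real)
    fix \<omega> assume "\<omega> \<in> space M"
    then have "(\<lambda>k. fk k \<omega> - f \<omega>) \<longlonglongrightarrow> 0"
      using that(2) by (intro Lim_null_comparison[OF _ \<delta>]) (simp add: abs_minus_commute)
    then show "(\<lambda>k. fk k \<omega>) \<longlonglongrightarrow> f \<omega>"
      by (simp add: LIM_zero_iff)
  qed (rule that(1))
  have Yk_meas [measurable]: "\<And>k n. Yk k n \<in> borel_measurable M"
    and Zk_meas [measurable]: "\<And>k. Zk k \<in> borel_measurable M"
    using conv by (auto simp: converges_in_prob_def)
  have Y_meas: "Y n \<in> borel_measurable M" for n
    using lim[of "\<lambda>k. Yk k n" "Y n"] Yk_meas Y by blast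
  have Z_meas: "Z \<in> borel_measurable M"
    using lim[of Zk Z] Zk_meas Z by blast
  have "(\<lambda>n. prob {\<omega> \<in> space M. \<bar>Y n \<omega> - Z \<omega>\<bar> > \<epsilon>}) \<longlonglongrightarrow> 0" if "\<epsilon> > 0" for \<epsilon>
  proof -
    have "\<forall>\<^sub>F k in sequentially. \<delta> k < \<epsilon> / 3"
      using order_tendstoD(2)[OF \<delta>, of "\<epsilon> / 3"] that by simp
    then obtain k where k: "\<delta> k < \<epsilon> / 3"
      by (meson eventually_happens trivial_limit_sequentially)
    have le: "prob {\<omega> \<in> space M. \<bar>Y n \<omega> - Z \<omega>\<bar> > \<epsilon>}
        \<le> prob {\<omega> \<in> space M. \<bar>Yk k n \<omega> - Zk k \<omega>\<bar> > \<epsilon> / 3}" for n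
    proof (rule finite_measure_mono)
      show "{\<omega> \<in> space M. \<bar>Y n \<omega> - Z \<omega>\<bar> > \<epsilon>} \<subseteq> {\<omega> \<in> space M. \<bar>Yk k n \<omega> - Zk k \<omega>\<bar> > \<epsilon> / 3}"
      proof safe
        fix \<omega> assume \<omega>: "\<omega> \<in> space M" "\<epsilon> < \<bar>Y n \<omega> - Z \<omega>\<bar>"
        show "\<epsilon> / 3 < \<bar>Yk k n \<omega> - Zk k \<omega>\<bar>"
          using Y[OF \<omega>(1), of n k] Z[OF \<omega>(1), of k] k \<omega>(2) by argo
      qed
    qed measurable
    have "\<epsilon> / 3 > 0" using that by simp
    then have lim: "(\<lambda>n. prob {\<omega> \<in> space M. \<bar>Yk k n \<omega> - Zk k \<omega>\<bar> > \<epsilon> / 3}) \<longlonglongrightarrow> 0"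
      using conv[of k] unfolding converges_in_prob_def by blast
    show ?thesis
      by (rule tendsto_sandwich[OF always_eventually always_eventually tendsto_const lim])
        (intro allI measure_nonneg le)+
  qed
  then show ?thesis
    using Y_meas Z_meas by (simp add: converges_in_prob_def)
qed


section \<open>The density of components\<close>

theorem proposition2p3:
  fixes M :: "'w measure"
    and d :: nat
    and X :: "nat \<Rightarrow> 'w \<Rightarrow> 'a scomplex"
    and \<mu> :: "'w \<Rightarrow> 'v rooted set measure"
  assumes "prob_space M"
    and "d \<ge> 1"
    and "infinite (UNIV :: 'v set)"
    and "\<And>n. random_finite_complex M d (X n)"
    and "\<mu> \<in> M \<rightarrow>\<^sub>M prob_algebra (rooted_class_space d)"
    and "local_weak_conv_in_prob M d X \<mu>"
  shows "converges_in_prob M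
           (\<lambda>n \<omega>. real (card (d_components d (X n \<omega>))) / real (card (simplices (d - 1) (X n \<omega>))))
           (\<lambda>\<omega>. \<integral>c. inv_component_size d c \<partial>(\<mu> \<omega>))"
proof -
  interpret prob_space M by fact
  let ?F = "\<lambda>k. small_classes d k :: 'v rooted set set"
  let ?w = "\<lambda>H :: 'v rooted set. 1 / real (class_size d H)"
  show ?thesis
  proof (rule converges_in_prob_uniform_approx)
    fix k
    show "converges_in_prob M (\<lambda>n \<omega>. \<Sum>H\<in>?F k. ?w H * nbhd_fraction d (X n \<omega>) k H)
        (\<lambda>\<omega>. \<Sum>H\<in>?F k. ?w H * nbhd_prob d (\<mu> \<omega>) k H)"
      using assms(6) small_classes_subset finite_small_classes[OF assms(3)]
      unfolding local_weak_conv_in_prob_def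
      by (intro converges_in_prob_sum converges_in_prob_cmult) blast+
  next
    fix k n \<omega> assume "\<omega> \<in> space M"
    then have "finite (X n \<omega>)" "simplicial_complex (X n \<omega>)"
      using assms(4)[of n] by (auto simp: random_finite_complex_def dim_complex_def)
    then show "\<bar>real (card (d_components d (X n \<omega>))) / real (card (simplices (d - 1) (X n \<omega>)))
        - (\<Sum>H\<in>?F k. ?w H * nbhd_fraction d (X n \<omega>) k H)\<bar> \<le> 1 / real (Suc k)"
      by (rule component_density_approx[OF assms(3,2)])
  next
    fix k \<omega> assume "\<omega> \<in> space M"
    then have "\<mu> \<omega> \<in> space (prob_algebra (rooted_class_space d))"
      using assms(5) by (rule measurable_space[rotated])
    then show "\<bar>(\<integral>c. inv_component_size d c \<partial>(\<mu> \<omega>))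
        - (\<Sum>H\<in>?F k. ?w H * nbhd_prob d (\<mu> \<omega>) k H)\<bar> \<le> 1 / real (Suc k)"
      by (intro expected_inv_size_approx[OF assms(3,2)]) (auto simp: space_prob_algebra)
  next
    show "(\<lambda>k. 1 / real (Suc k)) \<longlonglongrightarrow> 0"
      using LIMSEQ_inverse_real_of_nat by (simp add: inverse_eq_divide)
  qed
qed

end
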